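(* Let $n\ge 1$ and $\nu\ge 0$ be integers, let $U=U_1\times\cdots\times U_n\subset\mathbb{R}^n$ be a product of nondegenerate compact intervals, let $f\in\mathcal{C}^{\nu}(U)$ be a real-valued function, and let $\varepsilon>0$. Then there exist a number $M$ of overlapping, equally distributed fuzzy sets assigned to each input variable $x_1,\dots,x_n$ (giving $N=M^n$ rules) and a disturbed fuzzy system $$g(x,h)=\frac{\sum_{j=1}^{N}A_j(x)\,Q_{s,j}(h)\,P_{r,j}(h)}{\sum_{j=1}^{N}A_j(x)\,Q_{s,j}(h)}$$ built on these fuzzy sets, with polynomial disturbance functions $Q_{s,j},P_{r,j}$ and associated static fuzzy system $$g(x)=\frac{\sum_{j=1}^{N}A_j(x)\,\theta_j}{\sum_{j=1}^{N}A_j(x)},$$ such that: (i) $g(x)=\lim_{h\to 0} g(x,h)$ for every $x\in U$; (ii) $\displaystyle \sup_{x\in \mathrm{Supp}(f)}\ \lim_{h\to 0}\left| f(x)-g(x,h)\right|<\varepsilon$; (iii) $\displaystyle \sup_{x\in \mathrm{Supp}(f)}\ \lim_{h\to 0}\left| \frac{\partial^{i} f(x)}{\partial x^{i}}-\frac{\partial^{i} g(x,h)}{\partial h^{i}}\right|<\varepsilon$ for every multi-index $i\in\mathbb{Z}_{+}^{n}$ with $1\le |i|\le \nu$.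
   Context: **Functions and derivatives.** For a multi-index $i=(i_1,\dots,i_n)\in\mathbb{Z}_+^n$ (non-negative integers), $|i|=i_1+\cdots+i_n$ and $\frac{\partial^i f}{\partial x^i}=\frac{\partial^{|i|}f}{\partial x_1^{i_1}\cdots\partial x_n^{i_n}}$, and similarly for derivatives in $h=(h_1,\dots,h_n)\in\mathbb{R}^n$. $\mathcal{C}^\nu(U)$ is the set of real functions on $U$ whose partial derivatives of order at most $\nu$ exist and are continuous (on the interior of $U$, extending continuously to $U$; at boundary points the derivatives mean these extensions). $\mathrm{Supp}(f)=\{x\in U: f(x)\neq 0\}$; suprema over the empty set are taken to be $0$. **Fuzzy sets.** A fuzzy set $A$ on a set $X$ is identified with its membership function $A:X\to[0,1]$. It is normal if $A(x)=1$ for some $x$. It is convex if $A(\lambda x+(1-\lambda)y)\ge\min(A(x),A(y))$ for all $x,y$ and $\lambda\in[0,1]$. A collection $\{A_k\}$ of fuzzy sets on $X$ is complete if for each $x\in X$ some $A_k(x)>0$, and consistent if $A_k(x)=1$ implies $A_{k'}(x)=0$ for all $k'\ne k$. **Input partition.** For each $i=1,\dots,n$, the interval $U_i$ carries fuzzy sets $A_{i,1},\dots,A_{i,M}$ that are convex, normal, consistent and complete. They are ordered, with equally spaced centres $\bar x_{i,1}<\cdots<\bar x_{i,M}$ in $U_i$. The membership function $A_{i,k}$ is zero outside $[\bar x_{i,k-1},\bar x_{i,k+1}]$, increases monotonically on $[\bar x_{i,k-1},\bar x_{i,k}]$, equals $1$ at $\bar x_{i,k}$, decreases monotonically on $[\bar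 x_{i,k},\bar x_{i,k+1}]$, and is zero at $\bar x_{i,k+1}$. For $k=1$ and $k=M$ only the part inside $U_i$ is relevant. **Rules.** Rules are indexed by $j=(j_1,\dots,j_n)\in\{1,\dots,M\}^n$, enumerated as $j=1,\dots,N$ with $N=M^n$. The antecedent of rule $j$ has membership function $A_j(x)=A_{1,j_1}(x_1)\,A_{2,j_2}(x_2)\cdots A_{n,j_n}(x_n)$ (product T-norm), with central point $\bar x_j=(\bar x_{1,j_1},\dots,\bar x_{n,j_n})$. The number $\theta_j\in\mathbb{R}$ is the centre of the output fuzzy set of rule $j$. By completeness, $\sum_{j}A_j(x)>0$ on $U$. **Disturbed fuzzy system (DFS).** The input fuzzy sets are disturbed additively (multiplied by a factor $\varphi_j(h)=Q_{s,j}(h)$ tending to $1$ as $h\to0$). The output fuzzy sets are disturbed by translation (the centre $\theta_j$ is replaced by $\theta_j+\sigma_j(h)=P_{r,j}(h)$, with $\sigma_j(h)\to0$ as $h\to 0$). These disturbances are real polynomials in $h=(h_1,\dots,h_n)$, $$Q_{s,j}(h)=\sum_{d_1=0}^{s_1}\cdots\sum_{d_n=0}^{s_n}a^{j}_{d_1,\dots,d_n}h_1^{d_1}\cdots h_n^{d_n},\qquad P_{r,j}(h)=\sum_{d_1=0}^{r_1}\cdots\sum_{d_n=0}^{r_n}b^{j}_{d_1,\dots,d_n}h_1^{d_1}\cdots h_n^{d_n},$$ with non-negative integer degree vectors $s=(s_1,\dots,s_n)\le r=(r_1,\dots,r_n)$ (componentwise), $a^{j}_{0,\dots,0}=1$ and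 $b^{j}_{0,\dots,0}=\theta_j$ for all $j$. For each fixed $x\in U$ the denominator of $g(x,h)$ is nonzero for $h$ near $0$, so the limits in the claim make sense. *)

theory Defs
  imports "HOL-Analysis.Analysis"
begin

text \<open>
  Points of n-dimensional space have type \<open>real ^ 'n\<close> with \<open>'n :: {finite, linorder}\<close>; the linear
  order plays the role of the order of the coordinates 1, ..., n and fixes the order of
  differentiation in \<open>multi_derivative\<close>. Multi-indices are functions \<open>'n \<Rightarrow> nat\<close>.
\<close>

section \<open>Partial derivatives and continuously differentiable functions\<close>

definition partial_derivative :: "'n::finite \<Rightarrow> (real ^ 'n \<Rightarrow> real) \<Rightarrow> real ^ 'n \<Rightarrow> real" where
  "partial_derivative k F x = deriv (\<lambda>t. F (x + t *\<^sub>R axis k 1)) 0"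

definition multi_derivative ::
  "('n::{finite,linorder} \<Rightarrow> nat) \<Rightarrow> (real ^ 'n::{finite,linorder} \<Rightarrow> real) \<Rightarrow>
   real ^ 'n::{finite,linorder} \<Rightarrow> real" where
  "multi_derivative i F =
     foldr (\<lambda>k. partial_derivative k ^^ i k) (sorted_list_of_set UNIV) F"

text \<open>
  In \<open>C_on\<close>, a list of coordinates stands for an iterated partial derivative, so all mixed
  derivatives are covered, in every order of differentiation. As \<open>f\<close> is itself given on all of
  \<open>U\<close>, for order 0 we ask for its own continuity on \<open>U\<close>. Only the values of \<open>f\<close> on \<open>U\<close> matter.
\<close>

definition C_on :: "nat \<Rightarrow> (real ^ 'n::finite) set \<Rightarrow> (real ^ 'n \<Rightarrow> real) \<Rightarrow> bool" where
  "C_on \<nu> U f \<longleftrightarrow>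
     continuous_on U f \<and>
     (\<forall>ks k. length ks < \<nu> \<longrightarrow>
        (\<forall>x\<in>interior U.
           (\<lambda>t. foldr partial_derivative ks f (x + t *\<^sub>R axis k 1)) field_differentiable at 0)) \<and>
     (\<forall>ks. length ks \<le> \<nu> \<longrightarrow>
        (\<exists>G. continuous_on U G \<and> (\<forall>x\<in>interior U. G x = foldr partial_derivative ks f x)))"

text \<open>At boundary points, derivatives are the continuous extensions from the interior.\<close>

definition multi_derivative_on ::
  "(real ^ 'n::{finite,linorder}) set \<Rightarrow> ('n \<Rightarrow> nat) \<Rightarrow>
   (real ^ 'n::{finite,linorder} \<Rightarrow> real) \<Rightarrow> real ^ 'n::{finite,linorder} \<Rightarrow> real" where
  "multi_derivative_on U i f x =
     (if x \<in> interior U then multi_derivative i f x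
      else Lim (at x within interior U) (multi_derivative i f))"

definition Supp :: "(real ^ 'n) set \<Rightarrow> (real ^ 'n \<Rightarrow> real) \<Rightarrow> (real ^ 'n) set" where
  "Supp U f = {x \<in> U. f x \<noteq> 0}"


section \<open>Fuzzy sets\<close>

definition fuzzy_set :: "'a set \<Rightarrow> ('a \<Rightarrow> real) \<Rightarrow> bool" where
  "fuzzy_set X A \<longleftrightarrow> (\<forall>x\<in>X. 0 \<le> A x \<and> A x \<le> 1)"

definition fuzzy_normal :: "'a set \<Rightarrow> ('a \<Rightarrow> real) \<Rightarrow> bool" where
  "fuzzy_normal X A \<longleftrightarrow> (\<exists>x\<in>X. A x = 1)"

definition fuzzy_convex :: "'a::real_vector set \<Rightarrow> ('a \<Rightarrow> real) \<Rightarrow> bool" where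
  "fuzzy_convex X A \<longleftrightarrow>
     (\<forall>x\<in>X. \<forall>y\<in>X. \<forall>t\<in>{0..1}. A (t *\<^sub>R x + (1 - t) *\<^sub>R y) \<ge> min (A x) (A y))"

definition fuzzy_complete :: "'a set \<Rightarrow> 'k set \<Rightarrow> ('k \<Rightarrow> 'a \<Rightarrow> real) \<Rightarrow> bool" where
  "fuzzy_complete X K A \<longleftrightarrow> (\<forall>x\<in>X. \<exists>k\<in>K. A k x > 0)"

definition fuzzy_consistent :: "'a set \<Rightarrow> 'k set \<Rightarrow> ('k \<Rightarrow> 'a \<Rightarrow> real) \<Rightarrow> bool" where
  "fuzzy_consistent X K A \<longleftrightarrow>
     (\<forall>x\<in>X. \<forall>k\<in>K. A k x = 1 \<longrightarrow> (\<forall>k'\<in>K. k' \<noteq> k \<longrightarrow> A k' x = 0))"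

text \<open>
  An equally spaced partition of an interval \<open>X\<close> into \<open>M\<close> overlapping fuzzy sets \<open>A 1, ..., A M\<close>
  with centres \<open>c 1, ..., c M\<close>. The points \<open>c 0\<close> and \<open>c (M + 1)\<close> are not centres: they continue
  the equal spacing, possibly outside \<open>X\<close>, so that the first and the last set need no separate
  treatment.
\<close>

definition fuzzy_partition ::
  "real set \<Rightarrow> nat \<Rightarrow> (nat \<Rightarrow> real) \<Rightarrow> (nat \<Rightarrow> real \<Rightarrow> real) \<Rightarrow> bool" where
  "fuzzy_partition X M c A \<longleftrightarrow>
     1 \<le> M \<and>
     (\<forall>k\<in>{1..M}. c k \<in> X) \<and>
     (\<exists>\<delta>>0. \<forall>k\<in>{0..M}. c (k + 1) = c k + \<delta>) \<and>
     (\<forall>k\<in>{1..M}. fuzzy_set X (A k) \<and> fuzzy_normal X (A k) \<and> fuzzy_convex X (A k)) \<and>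
     fuzzy_complete X {1..M} A \<and>
     fuzzy_consistent X {1..M} A \<and>
     (\<forall>k\<in>{1..M}.
        (\<forall>x\<in>X. x \<notin> {c (k - 1)..c (k + 1)} \<longrightarrow> A k x = 0) \<and>
        mono_on (X \<inter> {c (k - 1)..c k}) (A k) \<and>
        A k (c k) = 1 \<and>
        antimono_on (X \<inter> {c k..c (k + 1)}) (A k) \<and>
        (c (k + 1) \<in> X \<longrightarrow> A k (c (k + 1)) = 0)) \<and>
     (\<forall>k\<in>{1..<M}. \<exists>x\<in>X. A k x > 0 \<and> A (k + 1) x > 0)"


section \<open>Disturbed fuzzy systems\<close>

text \<open>
  The \<open>M ^ n\<close> rules are indexed by \<open>j = (j\<^sub>1, ..., j\<^sub>n)\<close> directly, without passing to an
  enumeration \<open>1, ..., N\<close>.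
\<close>

definition rules :: "nat \<Rightarrow> ('n::finite \<Rightarrow> nat) set" where
  "rules M = (UNIV \<rightarrow>\<^sub>E {1..M})"

definition antecedent ::
  "('n::finite \<Rightarrow> nat \<Rightarrow> real \<Rightarrow> real) \<Rightarrow> ('n \<Rightarrow> nat) \<Rightarrow> real ^ 'n \<Rightarrow> real" where
  "antecedent A j x = (\<Prod>k\<in>UNIV. A k (j k) (x $ k))"

definition poly_fun ::
  "('n::finite \<Rightarrow> nat) \<Rightarrow> (('n \<Rightarrow> nat) \<Rightarrow> real) \<Rightarrow> real ^ 'n \<Rightarrow> real" where
  "poly_fun s a h = (\<Sum>d | \<forall>k. d k \<le> s k. a d * (\<Prod>k\<in>UNIV. (h $ k) ^ d k))"

definition static_fuzzy_system ::
  "nat \<Rightarrow> ('n::finite \<Rightarrow> nat \<Rightarrow> real \<Rightarrow> real) \<Rightarrow> (('n \<Rightarrow> nat) \<Rightarrow> real) \<Rightarrow> real ^ 'n \<Rightarrow> real" where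
  "static_fuzzy_system M A \<theta> x =
     (\<Sum>j\<in>rules M. antecedent A j x * \<theta> j) / (\<Sum>j\<in>rules M. antecedent A j x)"

definition disturbed_fuzzy_system ::
  "nat \<Rightarrow> ('n::finite \<Rightarrow> nat \<Rightarrow> real \<Rightarrow> real) \<Rightarrow>
   (('n \<Rightarrow> nat) \<Rightarrow> real ^ 'n \<Rightarrow> real) \<Rightarrow> (('n \<Rightarrow> nat) \<Rightarrow> real ^ 'n \<Rightarrow> real) \<Rightarrow>
   real ^ 'n \<Rightarrow> real ^ 'n \<Rightarrow> real" where
  "disturbed_fuzzy_system M A Q P x h =
     (\<Sum>j\<in>rules M. antecedent A j x * Q j h * P j h) / (\<Sum>j\<in>rules M. antecedent A j x * Q j h)"

end

theory Submission
  imports Defs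
begin

text \<open>
  Leave the input fuzzy sets undisturbed (\<open>Q = 1\<close>) and let \<open>P j\<close> be the Taylor polynomial of \<open>f\<close>
  at the centre of rule \<open>j\<close>. Then each derivative of \<open>g(x, h)\<close> in \<open>h\<close> at \<open>h = 0\<close> is a weighted
  average of the values of the corresponding derivative of \<open>f\<close> at the centres of the rules active
  at \<open>x\<close>. For a fine partition these centres are close to \<open>x\<close>, and uniform continuity of the
  finitely many derivatives of \<open>f\<close> on the compact box gives the bound.
\<close>

section \<open>Derivatives of polynomial functions\<close>

text \<open>The exponents \<open>e d\<close> are kept apart from the summation index
  \<open>d\<close>, so that the derivative has the same form over the same \<open>D\<close>,
  although different monomials may become equal. Truncated subtraction is harmless: if
  \<open>e d k = 0\<close>, the new coefficient is zero.\<close>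

lemma partial_derivative_monomial_sum:
  fixes e :: "'d \<Rightarrow> 'n::finite \<Rightarrow> nat"
  shows "partial_derivative k (\<lambda>h. \<Sum>d\<in>D. \<beta> d * (\<Prod>l\<in>UNIV. (h $ l) ^ e d l)) =
    (\<lambda>h. \<Sum>d\<in>D. (\<beta> d * real (e d k)) * (\<Prod>l\<in>UNIV. (h $ l) ^ ((e d)(k := e d k - 1)) l))"
proof
  fix h :: "real ^ 'n"
  have split: "(\<Prod>l\<in>UNIV. p l) = p k * (\<Prod>l\<in>UNIV - {k}. p l)" for p :: "'n \<Rightarrow> real"
    by (rule prod.remove) auto
  have shift: "(\<Prod>l\<in>UNIV. ((h + t *\<^sub>R axis k 1) $ l) ^ e d l) =
      (h $ k + t) ^ e d k * (\<Prod>l\<in>UNIV - {k}. (h $ l) ^ e d l)" for t d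
    unfolding split[of "\<lambda>l. ((h + t *\<^sub>R axis k 1) $ l) ^ e d l"]
    by (intro arg_cong2[where f = "(*)"] prod.cong) (auto simp: axis_def)
  have rest: "(\<Prod>l\<in>UNIV. (h $ l) ^ ((e d)(k := e d k - 1)) l) =
      (h $ k) ^ (e d k - 1) * (\<Prod>l\<in>UNIV - {k}. (h $ l) ^ e d l)" for d
    unfolding split[of "\<lambda>l. (h $ l) ^ ((e d)(k := e d k - 1)) l"]
    by (intro arg_cong2[where f = "(*)"] prod.cong) auto
  have "((\<lambda>t. \<Sum>d\<in>D. \<beta> d * ((h $ k + t) ^ e d k * (\<Prod>l\<in>UNIV - {k}. (h $ l) ^ e d l)))
      has_field_derivative
      (\<Sum>d\<in>D. \<beta> d * (real (e d k) * (h $ k) ^ (e d k - 1)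
         * (\<Prod>l\<in>UNIV - {k}. (h $ l) ^ e d l)))) (at 0)"
    by (auto intro!: derivative_eq_intros sum.cong simp: mult_ac)
  then show "partial_derivative k (\<lambda>h. \<Sum>d\<in>D. \<beta> d * (\<Prod>l\<in>UNIV. (h $ l) ^ e d l)) h =
    (\<Sum>d\<in>D. (\<beta> d * real (e d k)) * (\<Prod>l\<in>UNIV. (h $ l) ^ ((e d)(k := e d k - 1)) l))"
    unfolding partial_derivative_def shift rest by (subst DERIV_imp_deriv) (auto simp: mult_ac)
qed

lemma partial_derivative_funpow_monomial_sum:
  fixes e :: "'d \<Rightarrow> 'n::finite \<Rightarrow> nat"
  shows "(partial_derivative k ^^ m) (\<lambda>h. \<Sum>d\<in>D. \<beta> d * (\<Prod>l\<in>UNIV. (h $ l) ^ e d l)) =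
    (\<lambda>h. \<Sum>d\<in>D. (\<beta> d * (\<Prod>t<m. real (e d k) - real t)) *
       (\<Prod>l\<in>UNIV. (h $ l) ^ ((e d)(k := e d k - m)) l))"
proof (induction m)
  case 0
  then show ?case by simp
next
  case (Suc m)
  \<comment> \<open>One more derivative contributes the truncated difference \<open>q - m\<close>.
    For \<open>m > q\<close> the falling factorial already contains a zero factor, so both sides
    vanish.\<close>
  have coeff: "b * (\<Prod>t<m. real q - real t) * real (q - m) = b * (\<Prod>t<Suc m. real q - real t)"
    for q b
  proof (cases "m \<le> q")
    case False
    then have "(\<Prod>t<m. real q - real t) = 0" by (intro prod_zero) auto
    then show ?thesis by simp
  qed (simp add: of_nat_diff)
  show ?case
    by (simp only: funpow.simps o_apply Suc.IH partial_derivative_monomial_sum fun_upd_same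
          fun_upd_upd coeff diff_diff_left Suc_eq_plus1[symmetric])
qed

text \<open>Distinctness of \<open>ks\<close> ensures that the exponent of a coordinate is still the
  original one when that coordinate is differentiated, so the falling factorials simply
  multiply.\<close>

lemma foldr_partial_derivative_monomial_sum:
  fixes e :: "'d \<Rightarrow> 'n::finite \<Rightarrow> nat"
  assumes "distinct ks"
  shows "foldr (\<lambda>k. partial_derivative k ^^ i k) ks
      (\<lambda>h. \<Sum>d\<in>D. \<beta> d * (\<Prod>l\<in>UNIV. (h $ l) ^ e d l)) =
    (\<lambda>h. \<Sum>d\<in>D. (\<beta> d * (\<Prod>k\<in>set ks. \<Prod>t<i k. real (e d k) - real t)) *
       (\<Prod>l\<in>UNIV. (h $ l) ^ (if l \<in> set ks then e d l - i l else e d l)))"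
  using assms
proof (induction ks)
  case Nil
  then show ?case by simp
next
  case (Cons k ks)
  then have k: "k \<notin> set ks" and "distinct ks" by auto
  show ?case
    unfolding foldr_Cons o_apply Cons.IH[OF \<open>distinct ks\<close>] partial_derivative_funpow_monomial_sum
    by (intro ext sum.cong refl, rule arg_cong2[where f = "(*)"])
      (use k in \<open>simp add: mult_ac\<close>, use k in \<open>auto intro!: prod.cong\<close>)
qed

text \<open>At the origin only the monomial with exponent \<open>i\<close> survives, and its falling
  factorials become factorials. The bound by \<open>r\<close> places \<open>i\<close> in the range
  of summation.\<close>

lemma tendsto_multi_derivative_poly_fun:
  fixes \<beta> :: "('n::{finite,linorder} \<Rightarrow> nat) \<Rightarrow> real"
  assumes "\<And>k. i k \<le> r k"
  shows "(multi_derivative i (poly_fun r \<beta>) \<longlongrightarrow> \<beta> i * (\<Prod>k\<in>UNIV. fact (i k))) (at 0)"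
proof -
  let ?z = "0 :: real ^ 'n::{finite,linorder}"
  let ?D = "{d. \<forall>k. d k \<le> r k}"
  let ?c = "\<lambda>d. \<Prod>k\<in>UNIV. \<Prod>t<i k. real (d k) - real t"
  have eq: "multi_derivative i (poly_fun r \<beta>) =
      (\<lambda>h. \<Sum>d\<in>?D. \<beta> d * ?c d * (\<Prod>l\<in>UNIV. (h $ l) ^ (d l - i l)))"
    unfolding multi_derivative_def poly_fun_def
    using foldr_partial_derivative_monomial_sum[of "sorted_list_of_set UNIV" i \<beta> "\<lambda>d. d" ?D]
    by simp
  have "?D = Pi\<^sub>E UNIV (\<lambda>k. {..r k})" by (auto simp: PiE_def Pi_def)
  then have fin: "finite ?D" by (simp add: finite_PiE)
  \<comment> \<open>A coordinate with \<open>d k < i k\<close> kills the coefficient; one with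
    \<open>d k > i k\<close> leaves a positive power of zero.\<close>
  have zero: "?c d * (\<Prod>l\<in>UNIV. (?z $ l) ^ (d l - i l)) = 0" if ne: "d \<noteq> i" for d
  proof -
    from ne obtain k where k: "d k \<noteq> i k" by auto
    show ?thesis
    proof (cases "d k < i k")
      case True
      then have "(\<Prod>t<i k. real (d k) - real t) = 0" by (intro prod_zero) auto
      then have "?c d = 0" by (intro prod_zero) auto
      then show ?thesis by simp
    next
      case False
      with k have "(\<Prod>l\<in>UNIV. (?z $ l) ^ (d l - i l)) = 0"
        by (intro prod_zero) (auto intro!: exI[of _ k])
      then show ?thesis by simp
    qed
  qed
  have "(\<Prod>t<m. real m - real t) = fact m" for m :: nat
  proof -
    have "(\<Prod>t<m. real m - real t) = (\<Prod>t<m. real (m - t))" by (rule prod.cong) auto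
    then show ?thesis by (simp add: fact_prod_rev[of m] lessThan_atLeast0)
  qed
  then have c: "?c i = (\<Prod>k\<in>UNIV. fact (i k))" by simp
  have "(multi_derivative i (poly_fun r \<beta>) \<longlongrightarrow>
      (\<Sum>d\<in>?D. \<beta> d * ?c d * (\<Prod>l\<in>UNIV. (?z $ l) ^ (d l - i l)))) (at 0)"
    unfolding eq by (intro tendsto_intros)
  also have "(\<Sum>d\<in>?D. \<beta> d * ?c d * (\<Prod>l\<in>UNIV. (?z $ l) ^ (d l - i l))) =
      (\<Sum>d\<in>?D. if d = i then \<beta> i * (\<Prod>k\<in>UNIV. fact (i k)) else 0)"
  proof (intro sum.cong refl)
    fix d
    show "\<beta> d * ?c d * (\<Prod>l\<in>UNIV. (?z $ l) ^ (d l - i l)) =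
        (if d = i then \<beta> i * (\<Prod>k\<in>UNIV. fact (i k)) else 0)"
    proof (cases "d = i")
      case True
      then show ?thesis by (simp add: c)
    next
      case False
      then show ?thesis by (simp only: mult.assoc zero[OF False] mult_zero_right if_False)
    qed
  qed
  also have "\<dots> = \<beta> i * (\<Prod>k\<in>UNIV. fact (i k))"
    using fin assms by simp
  finally show ?thesis .
qed

section \<open>Continuous extension of the derivatives\<close>

text \<open>Bridge from multi-indices to the coordinate lists used in \<open>C_on\<close>.\<close>

lemma foldr_funpow_conv_foldr:
  "foldr (\<lambda>k. g k ^^ i k) ks F = foldr g (concat (map (\<lambda>k. replicate (i k) k) ks)) F"
proof (induction ks)
  case (Cons k ks)
  have "foldr g (replicate m k) F' = (g k ^^ m) F'" for m F'
    by (induction m) auto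
  with Cons show ?case by simp
qed simp

text \<open>The extension provided by \<open>C_on\<close> agrees with the derivative in the
  interior. As the box is nondegenerate, its interior is dense in it, so at a boundary point the
  limit from the interior is unique and equals the value of the extension.\<close>

lemma multi_derivative_on_eq_continuous:
  fixes f :: "real ^ 'n::{finite,linorder} \<Rightarrow> real"
  assumes "\<And>k. u $ k < v $ k" and "C_on \<nu> (cbox u v) f" and "(\<Sum>k\<in>UNIV. i k) \<le> \<nu>"
  obtains G where "continuous_on (cbox u v) G"
    and "\<And>x. x \<in> cbox u v \<Longrightarrow> multi_derivative_on (cbox u v) i f x = G x"
proof -
  define ks where "ks = concat (map (\<lambda>k. replicate (i k) k) (sorted_list_of_set UNIV))"
  have ks: "multi_derivative i f = foldr partial_derivative ks f"
    unfolding multi_derivative_def ks_def by (rule foldr_funpow_conv_foldr)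
  have "length ks = (\<Sum>k\<in>UNIV. i k)"
    by (simp add: ks_def length_concat o_def sum_list_distinct_conv_sum_set)
  then obtain G where G: "continuous_on (cbox u v) G"
      "\<And>x. x \<in> box u v \<Longrightarrow> G x = multi_derivative i f x"
    using assms(2,3) unfolding C_on_def ks interior_cbox by metis
  have "box u v \<noteq> {}" using assms(1) by (simp add: box_ne_empty Basis_vec_def inner_axis)
  then have closure: "closure (box u v) = cbox u v" by (rule closure_box)
  have "multi_derivative_on (cbox u v) i f x = G x" if x: "x \<in> cbox u v" for x
  proof (cases "x \<in> box u v")
    case True
    then show ?thesis by (simp add: multi_derivative_on_def G)
  next
    case False
    with x closure have "x islimpt box u v" by (auto simp: closure_def)
    then have nontriv: "at x within box u v \<noteq> bot" by (simp add: trivial_limit_within)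
    have "(G \<longlongrightarrow> G x) (at x within box u v)"
      using G(1) x box_subset_cbox[of u v] by (meson continuous_on_def tendsto_within_subset)
    moreover have "eventually (\<lambda>y. G y = multi_derivative i f y) (at x within box u v)"
      by (auto simp: eventually_at_filter G)
    ultimately have "(multi_derivative i f \<longlongrightarrow> G x) (at x within box u v)"
      by (rule Lim_transform_eventually)
    then show ?thesis
      using False nontriv by (simp add: multi_derivative_on_def tendsto_Lim)
  qed
  with G(1) show ?thesis by (rule that)
qed

section \<open>Triangular fuzzy partitions\<close>

text \<open>The subtraction is done in the reals, so that index 0 gives \<open>p - w\<close>, the
  point one step before the first centre \<open>p\<close>.\<close>

definition grid :: "real \<Rightarrow> real \<Rightarrow> nat \<Rightarrow> real" where
  "grid p w k = p + (real k - 1) * w"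

definition triangle :: "real \<Rightarrow> real \<Rightarrow> nat \<Rightarrow> real \<Rightarrow> real" where
  "triangle p w k x = max 0 (1 - \<bar>x - grid p w k\<bar> / w)"

lemma triangle_nonneg: "0 \<le> triangle p w k x"
  by (simp add: triangle_def)

lemma triangle_pos_iff: "w > 0 \<Longrightarrow> 0 < triangle p w k x \<longleftrightarrow> \<bar>x - grid p w k\<bar> < w"
  by (auto simp: triangle_def less_max_iff_disj divide_less_eq)

text \<open>The height depends only on the distance to the centre. Both monotonicity and convexity
  of the fuzzy sets follow from this.\<close>

lemma triangle_mono:
  "w > 0 \<Longrightarrow> \<bar>y - grid p w k\<bar> \<le> \<bar>x - grid p w k\<bar> \<Longrightarrow> triangle p w k x \<le> triangle p w k y"
  unfolding triangle_def by (intro max.mono diff_mono divide_right_mono) auto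

text \<open>Cutting the interval into \<open>m\<close> cells gives \<open>m + 1\<close> centres, the
  first and last of which are the endpoints.\<close>

lemma fuzzy_partition_triangle:
  fixes p q :: real
  assumes "p < q" and "m \<ge> 1"
  defines "w \<equiv> (q - p) / real m"
  shows "fuzzy_partition {p..q} (m + 1) (grid p w) (triangle p w)"
proof -
  have w: "w > 0" using assms by simp
  have q: "q = p + real m * w" using assms by (simp add: w_def)
  have grid_Suc: "grid p w (k + 1) = grid p w k + w" for k
    by (simp add: grid_def algebra_simps)
  have grid_pred: "grid p w (k - 1) = grid p w k - w" if "k \<ge> 1" for k
    using that by (simp add: grid_def algebra_simps of_nat_diff)
  have grid_mem: "grid p w k \<in> {p..q}" if "k \<in> {1..m+1}" for k
  proof -
    have "real k - 1 \<le> real m" "0 \<le> real k - 1" using that by auto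
    then show ?thesis using w by (simp add: grid_def q mult_right_mono)
  qed
  have zero: "triangle p w k x = 0" if "\<bar>x - grid p w k\<bar> \<ge> w" for k x
    using that w by (simp add: triangle_def)
  have one: "triangle p w k x = 1 \<longleftrightarrow> x = grid p w k" for k x
    using w by (auto simp: triangle_def max_def)
  \<comment> \<open>The distance to the centre is a convex function, so a point between
    \<open>x\<close> and \<open>y\<close> is no farther from the centre than the farther of the
    two.\<close>
  have convex: "fuzzy_convex {p..q} (triangle p w k)" for k
    unfolding fuzzy_convex_def
  proof (intro ballI)
    fix x y t :: real
    assume t: "t \<in> {0..1}"
    let ?c = "grid p w k" and ?z = "t *\<^sub>R x + (1 - t) *\<^sub>R y"
    have "\<bar>?z - ?c\<bar> = \<bar>t * (x - ?c) + (1 - t) * (y - ?c)\<bar>"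
      by (simp add: algebra_simps)
    also have "\<dots> \<le> t * \<bar>x - ?c\<bar> + (1 - t) * \<bar>y - ?c\<bar>"
      using t by (intro order_trans[OF abs_triangle_ineq]) (simp add: abs_mult)
    also have "\<dots> \<le> max \<bar>x - ?c\<bar> \<bar>y - ?c\<bar>"
      using t by (intro convex_bound_le) auto
    finally have "\<bar>?z - ?c\<bar> \<le> \<bar>x - ?c\<bar> \<or> \<bar>?z - ?c\<bar> \<le> \<bar>y - ?c\<bar>" by linarith
    then show "min (triangle p w k x) (triangle p w k y) \<le> triangle p w k ?z"
      using triangle_mono[OF w] by (auto simp: min_le_iff_disj)
  qed
  have complete: "fuzzy_complete {p..q} {1..m+1} (triangle p w)"
    unfolding fuzzy_complete_def
  proof
    fix x assume x: "x \<in> {p..q}"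
    \<comment> \<open>The index of the last centre not to the right of \<open>x\<close>; for
      \<open>x = q\<close> it is \<open>m + 1\<close>.\<close>
    define k where "k = nat \<lfloor>(x - p) / w\<rfloor> + 1"
    have nn: "0 \<le> (x - p) / w" using x w by simp
    have "(x - p) / w \<le> real m" using x w q by (simp add: field_simps)
    then have "k \<in> {1..m+1}" using nn by (simp add: k_def) linarith
    moreover have "real k - 1 \<le> (x - p) / w" "(x - p) / w < real k"
      using nn by (simp_all add: k_def) linarith+
    then have "\<bar>x - grid p w k\<bar> < w"
      using w by (simp add: grid_def field_simps)
    ultimately show "\<exists>k\<in>{1..m+1}. 0 < triangle p w k x"
      using triangle_pos_iff[OF w] by blast
  qed
  \<comment> \<open>A triangle has height 1 only at its own centre, and any other centre is at least
    \<open>w\<close> away.\<close>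
  have consistent: "fuzzy_consistent {p..q} {1..m+1} (triangle p w)"
    unfolding fuzzy_consistent_def one
  proof (intro ballI impI)
    fix x k k' assume "x = grid p w k" "k' \<noteq> k"
    then have "x - grid p w k' = (real k - real k') * w" "1 \<le> \<bar>real k - real k'\<bar>"
      by (auto simp: grid_def algebra_simps)
    then show "triangle p w k' x = 0"
      using w mult_right_mono[of 1 "\<bar>real k - real k'\<bar>" w] by (intro zero) (simp add: abs_mult)
  qed
  have overlap: "\<exists>x\<in>{p..q}. 0 < triangle p w k x \<and> 0 < triangle p w (k + 1) x"
    if "k \<in> {1..<m+1}" for k
  proof (intro bexI conjI)
    show "grid p w k + w / 2 \<in> {p..q}"
      using grid_mem[of k] grid_mem[of "k + 1"] that w unfolding grid_Suc by auto
  qed (use w in \<open>simp_all add: triangle_pos_iff grid_Suc[simplified]\<close>)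
  have local_shape: "(\<forall>x\<in>{p..q}. x \<notin> {grid p w (k - 1)..grid p w (k + 1)} \<longrightarrow> triangle p w k x = 0) \<and>
      mono_on ({p..q} \<inter> {grid p w (k - 1)..grid p w k}) (triangle p w k) \<and>
      triangle p w k (grid p w k) = 1 \<and>
      antimono_on ({p..q} \<inter> {grid p w k..grid p w (k + 1)}) (triangle p w k) \<and>
      (grid p w (k + 1) \<in> {p..q} \<longrightarrow> triangle p w k (grid p w (k + 1)) = 0)"
    if "k \<in> {1..m+1}" for k
  proof -
    from that have "k \<ge> 1" by simp
    show ?thesis
      unfolding grid_Suc grid_pred[OF \<open>k \<ge> 1\<close>]
      using w by (auto simp: one monotone_on_def intro!: zero triangle_mono)
  qed
  show ?thesis
    unfolding fuzzy_partition_def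
  proof (intro conjI)
    show "\<exists>\<delta>>0. \<forall>k\<in>{0..m+1}. grid p w (k + 1) = grid p w k + \<delta>"
      using w grid_Suc by blast
    show "\<forall>k\<in>{1..m+1}. fuzzy_set {p..q} (triangle p w k) \<and> fuzzy_normal {p..q} (triangle p w k) \<and>
        fuzzy_convex {p..q} (triangle p w k)"
      using convex grid_mem one w
      by (auto simp: fuzzy_set_def fuzzy_normal_def triangle_nonneg triangle_def)
    show "\<forall>k\<in>{1..m+1}. grid p w k \<in> {p..q}"
      using grid_mem by blast
  qed (use complete consistent overlap local_shape in auto)
qed

section \<open>Undisturbed inputs\<close>

lemma finite_rules: "finite (rules M :: ('n::finite \<Rightarrow> nat) set)"
  by (simp add: rules_def finite_PiE)

lemma antecedent_nonneg: "(\<And>k l y. 0 \<le> A k l y) \<Longrightarrow> 0 \<le> antecedent A j x"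
  by (simp add: antecedent_def prod_nonneg)

text \<open>Choosing an active fuzzy set in each coordinate yields a rule with positive weight; no
  other rule can cancel it.\<close>

lemma sum_antecedent_pos:
  assumes "\<And>k l y. 0 \<le> A k l y" and "\<And>k. \<exists>l\<in>{1..M}. 0 < A k l (x $ k)"
  shows "0 < (\<Sum>j\<in>rules M. antecedent A j x)"
proof -
  obtain j where j: "\<And>k. j k \<in> {1..M}" "\<And>k. 0 < A k (j k) (x $ k)"
    using assms(2) by metis
  then have "j \<in> rules M" "0 < antecedent A j x"
    by (auto simp: rules_def antecedent_def intro!: prod_pos)
  then show ?thesis
    by (intro sum_pos2[OF finite_rules] antecedent_nonneg assms(1))
qed

text \<open>With constant \<open>Q = 1\<close> the denominator does not depend on \<open>h\<close>.
  Hence the system is a polynomial in \<open>h\<close> whose coefficients are weighted averages over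
  the rules, and no quotient has to be differentiated.\<close>

lemma disturbed_fuzzy_system_undisturbed_inputs:
  fixes x :: "real ^ 'n::finite"
  shows "disturbed_fuzzy_system M A (\<lambda>j. poly_fun (\<lambda>_. 0) (\<lambda>_. 1)) (\<lambda>j. poly_fun r (b j)) x =
    poly_fun r (\<lambda>d. static_fuzzy_system M A (\<lambda>j. b j d) x)"
proof
  fix h :: "real ^ 'n"
  have "{d :: 'n \<Rightarrow> nat. \<forall>k. d k \<le> 0} = {\<lambda>_. 0}" by auto
  then have one: "poly_fun (\<lambda>_. 0) (\<lambda>_. 1) h = 1"
    by (simp add: poly_fun_def)
  have swap: "(\<Sum>j\<in>rules M. antecedent A j x * poly_fun r (b j) h) =
      (\<Sum>d | \<forall>k. d k \<le> r k. (\<Sum>j\<in>rules M. antecedent A j x * b j d) * (\<Prod>k\<in>UNIV. (h $ k) ^ d k))"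
    unfolding poly_fun_def sum_distrib_left sum_distrib_right
    by (subst sum.swap) (simp only: mult.assoc)
  have scale: "poly_fun r (\<lambda>d. S d / W) h =
      (\<Sum>d | \<forall>k. d k \<le> r k. S d * (\<Prod>k\<in>UNIV. (h $ k) ^ d k)) / W" for S W
    by (simp add: poly_fun_def sum_divide_distrib)
  show "disturbed_fuzzy_system M A (\<lambda>j. poly_fun (\<lambda>_. 0) (\<lambda>_. 1)) (\<lambda>j. poly_fun r (b j)) x h =
      poly_fun r (\<lambda>d. static_fuzzy_system M A (\<lambda>j. b j d) x) h"
    unfolding disturbed_fuzzy_system_def static_fuzzy_system_def one mult_1_right swap scale ..
qed

text \<open>The error is the weighted average of the errors \<open>y - \<theta> j\<close>, with
  nonnegative weights; rules of weight zero do not contribute.\<close>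

lemma static_fuzzy_system_close:
  assumes "\<And>k l y. 0 \<le> A k l y" and "0 < (\<Sum>j\<in>rules M. antecedent A j x)"
    and "\<And>j. j \<in> rules M \<Longrightarrow> antecedent A j x \<noteq> 0 \<Longrightarrow> \<bar>y - \<theta> j\<bar> \<le> e"
  shows "\<bar>y - static_fuzzy_system M A \<theta> x\<bar> \<le> e"
proof -
  let ?w = "\<lambda>j. antecedent A j x" and ?W = "\<Sum>j\<in>rules M. antecedent A j x"
  have "(\<Sum>j\<in>rules M. ?w j * (y - \<theta> j)) = y * ?W - (\<Sum>j\<in>rules M. ?w j * \<theta> j)"
    by (simp add: right_diff_distrib sum_subtractf sum_distrib_left mult.commute)
  then have "y - static_fuzzy_system M A \<theta> x = (\<Sum>j\<in>rules M. ?w j * (y - \<theta> j)) / ?W"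
    using assms(2) by (simp add: static_fuzzy_system_def diff_divide_distrib)
  moreover have "\<bar>\<Sum>j\<in>rules M. ?w j * (y - \<theta> j)\<bar> \<le> ?W * e"
    unfolding sum_distrib_right
  proof (rule sum_abs[THEN order_trans], rule sum_mono)
    fix j :: "'a \<Rightarrow> nat" assume j: "j \<in> rules M"
    show "\<bar>?w j * (y - \<theta> j)\<bar> \<le> ?w j * e"
      using assms(3)[OF j] antecedent_nonneg[of A j x, OF assms(1)]
      by (cases "?w j = 0") (auto simp: abs_mult intro!: mult_left_mono)
  qed
  ultimately show ?thesis
    using assms(2)
    by (simp add: abs_divide divide_le_eq mult.commute[of e])
qed

text \<open>Strict pointwise bounds may become equality in a supremum, hence the margin
  \<open>\<epsilon> / 2\<close>. In \<open>ennreal\<close> the supremum over an empty set is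
  0.\<close>

lemma SUP_Lim_less:
  fixes F :: "'a \<Rightarrow> 'b \<Rightarrow> real"
  assumes "\<And>x. x \<in> S \<Longrightarrow> (F x \<longlongrightarrow> L x) net" and "\<And>x. x \<in> S \<Longrightarrow> L x \<le> \<epsilon> / 2"
    and "\<epsilon> > 0" and "net \<noteq> bot"
  shows "(SUP x\<in>S. ennreal (Lim net (F x))) < ennreal \<epsilon>"
proof -
  have "(SUP x\<in>S. ennreal (Lim net (F x))) \<le> ennreal (\<epsilon> / 2)"
    by (intro SUP_least ennreal_leI)
      (simp only: tendsto_Lim[OF assms(4) assms(1)] assms(2))
  also have "\<dots> < ennreal \<epsilon>" using assms(3) by (simp add: ennreal_less_iff)
  finally show ?thesis .
qed

lemma multi_index_le_order: "i k \<le> (\<Sum>k\<in>UNIV. i k)" for i :: "'n::finite \<Rightarrow> nat"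
  by (rule member_le_sum) auto

text \<open>Finiteness lets one mesh size serve all derivatives at once.\<close>

lemma finite_multi_indices: "finite {i :: 'n::finite \<Rightarrow> nat. (\<Sum>k\<in>UNIV. i k) \<le> \<nu>}"
proof (rule finite_subset)
  show "{i :: 'n \<Rightarrow> nat. (\<Sum>k\<in>UNIV. i k) \<le> \<nu>} \<subseteq> UNIV \<rightarrow>\<^sub>E {..\<nu>}"
    using multi_index_le_order le_trans by (fastforce simp: PiE_iff)
qed (simp add: finite_PiE)

section \<open>Construction of the approximating system and its error estimate\<close>

theorem theorem2:
  fixes f :: "real ^ 'n::{finite,linorder} \<Rightarrow> real"
    and u v :: "real ^ 'n::{finite,linorder}"
    and \<nu> :: nat
    and \<epsilon> :: real
  assumes "\<And>k. u $ k < v $ k"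
    and "C_on \<nu> (cbox u v) f"
    and "\<epsilon> > 0"
  shows "\<exists>(M::nat) (c :: 'n \<Rightarrow> nat \<Rightarrow> real) (A :: 'n \<Rightarrow> nat \<Rightarrow> real \<Rightarrow> real)
            (\<theta> :: ('n \<Rightarrow> nat) \<Rightarrow> real) (s :: 'n \<Rightarrow> nat) (r :: 'n \<Rightarrow> nat)
            (a :: ('n \<Rightarrow> nat) \<Rightarrow> ('n \<Rightarrow> nat) \<Rightarrow> real) (b :: ('n \<Rightarrow> nat) \<Rightarrow> ('n \<Rightarrow> nat) \<Rightarrow> real).
     (\<forall>k. fuzzy_partition {u $ k..v $ k} M (c k) (A k)) \<and>
     (\<forall>k. s k \<le> r k) \<and>
     (\<forall>j\<in>rules M. a j (\<lambda>_. 0) = 1 \<and> b j (\<lambda>_. 0) = \<theta> j) \<and>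
     (let U = cbox u v;
          g = disturbed_fuzzy_system M A (\<lambda>j. poly_fun s (a j)) (\<lambda>j. poly_fun r (b j))
      in (\<forall>x\<in>U. (g x \<longlongrightarrow> static_fuzzy_system M A \<theta> x) (at 0)) \<and>
         ((\<forall>x\<in>Supp U f. \<exists>l. ((\<lambda>h. \<bar>f x - g x h\<bar>) \<longlongrightarrow> l) (at 0)) \<and>
          (SUP x\<in>Supp U f. ennreal (Lim (at 0) (\<lambda>h. \<bar>f x - g x h\<bar>))) < ennreal \<epsilon>) \<and>
         (\<forall>i. 1 \<le> (\<Sum>k\<in>UNIV. i k) \<and> (\<Sum>k\<in>UNIV. i k) \<le> \<nu> \<longrightarrow>
            (\<forall>x\<in>Supp U f. \<exists>l.
               ((\<lambda>h. \<bar>multi_derivative_on U i f x - multi_derivative i (g x) h\<bar>) \<longlongrightarrow> l) (at 0)) \<and>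
            (SUP x\<in>Supp U f. ennreal (Lim (at 0)
               (\<lambda>h. \<bar>multi_derivative_on U i f x - multi_derivative i (g x) h\<bar>))) < ennreal \<epsilon>))"
proof -
  let ?U = "cbox u v" and ?I = "{i :: 'n \<Rightarrow> nat. (\<Sum>k\<in>UNIV. i k) \<le> \<nu>}"
  have le_\<nu>: "i k \<le> \<nu>" if "i \<in> ?I" for i k
    using that le_trans[OF multi_index_le_order] by blast
  \<comment> \<open>\<open>G i\<close> is the continuous version on the whole box of the derivative
    of order \<open>i\<close>. At order zero it has to be \<open>f\<close> itself, since the
    zeroth-order claims speak of \<open>f\<close> and not of an extension.\<close>
  have "\<forall>i. \<exists>G. i \<in> ?I \<longrightarrow> continuous_on ?U G \<and> (i = (\<lambda>_. 0) \<longrightarrow> G = f) \<and>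
      ((\<Sum>k\<in>UNIV. i k) \<ge> 1 \<longrightarrow> (\<forall>x\<in>?U. multi_derivative_on ?U i f x = G x))"
  proof
    fix i :: "'n \<Rightarrow> nat"
    show "\<exists>G. i \<in> ?I \<longrightarrow> continuous_on ?U G \<and> (i = (\<lambda>_. 0) \<longrightarrow> G = f) \<and>
      ((\<Sum>k\<in>UNIV. i k) \<ge> 1 \<longrightarrow> (\<forall>x\<in>?U. multi_derivative_on ?U i f x = G x))"
    proof (cases "i = (\<lambda>_. 0)")
      case True
      then show ?thesis using assms(2) by (intro exI[of _ f]) (simp add: C_on_def)
    next
      case False
      show ?thesis
      proof (cases "i \<in> ?I")
        case True
        with False show ?thesis
          using multi_derivative_on_eq_continuous[OF assms(1,2), of i]
          by (metis (mono_tags, lifting) mem_Collect_eq)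
      qed simp
    qed
  qed
  then obtain G where G: "\<And>i. i \<in> ?I \<Longrightarrow> continuous_on ?U (G i)"
      "(\<lambda>_. 0) \<in> ?I \<Longrightarrow> G (\<lambda>_. 0) = f"
      "\<And>i x. i \<in> ?I \<Longrightarrow> (\<Sum>k\<in>UNIV. i k) \<ge> 1 \<Longrightarrow> x \<in> ?U \<Longrightarrow> multi_derivative_on ?U i f x = G i x"
    unfolding choice_iff by blast
  have I0: "(\<lambda>_. 0) \<in> ?I" by simp
  then have G0: "G (\<lambda>_. 0) = f" by (rule G(2))
  have "\<forall>i\<in>?I. \<exists>\<eta>>0. \<forall>x\<in>?U. \<forall>y\<in>?U. dist x y < \<eta> \<longrightarrow> \<bar>G i x - G i y\<bar> < \<epsilon> / 2"
  proof
    fix i assume "i \<in> ?I"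
    then have "uniformly_continuous_on ?U (G i)"
      by (intro compact_uniformly_continuous G compact_cbox)
    then show "\<exists>\<eta>>0. \<forall>x\<in>?U. \<forall>y\<in>?U. dist x y < \<eta> \<longrightarrow> \<bar>G i x - G i y\<bar> < \<epsilon> / 2"
      using assms(3) unfolding uniformly_continuous_on_def dist_real_def
      by (metis dist_commute half_gt_zero)
  qed
  then obtain \<eta> where \<eta>: "\<And>i. i \<in> ?I \<Longrightarrow> \<eta> i > 0"
      "\<And>i x y. i \<in> ?I \<Longrightarrow> x \<in> ?U \<Longrightarrow> y \<in> ?U \<Longrightarrow> dist x y < \<eta> i \<Longrightarrow> \<bar>G i x - G i y\<bar> < \<epsilon> / 2"
    by metis
  \<comment> \<open>A common modulus for all derivatives: the minimum of finitely many positive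
    numbers.\<close>
  define \<eta>0 where "\<eta>0 = Min (\<eta> ` ?I)"
  have \<eta>0: "\<eta>0 > 0" "\<And>i. i \<in> ?I \<Longrightarrow> \<eta>0 \<le> \<eta> i"
  proof -
    have fin: "finite (\<eta> ` ?I)" using finite_multi_indices by blast
    with I0 \<eta>(1) show "\<eta>0 > 0" unfolding \<eta>0_def by (subst Min_gr_iff) blast+
    show "\<eta>0 \<le> \<eta> i" if "i \<in> ?I" for i
      unfolding \<eta>0_def using fin that by (intro Min_le) auto
  qed

  \<comment> \<open>With this many cells per side, the cell widths add up to less than
    \<open>\<eta>0\<close>. This sum bounds the l1 distance from a point to the centre of any rule
    active there.\<close>
  obtain m0 :: nat where m0: "(\<Sum>k\<in>UNIV. v $ k - u $ k) / \<eta>0 < real m0"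
    using reals_Archimedean2 by blast
  define m where "m = max 1 m0"
  have m: "m \<ge> 1" "(\<Sum>k\<in>UNIV. v $ k - u $ k) / \<eta>0 < real m"
    using m0 by (auto simp: m_def)
  define M where "M = m + 1"
  define w where "w k = (v $ k - u $ k) / real m" for k
  define c where "c k = grid (u $ k) (w k)" for k
  define A where "A k = triangle (u $ k) (w k)" for k
  have w: "w k > 0" for k using assms(1) m by (simp add: w_def)
  have sum_w_eq: "(\<Sum>k\<in>UNIV. w k) = (\<Sum>k\<in>UNIV. v $ k - u $ k) / real m"
    by (simp add: w_def sum_divide_distrib)
  have sum_w: "(\<Sum>k\<in>UNIV. w k) < \<eta>0"
    unfolding sum_w_eq using m \<eta>0(1) by (simp add: divide_less_eq mult.commute)
  have part: "fuzzy_partition {u $ k..v $ k} M (c k) (A k)" for k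
    unfolding M_def c_def A_def w_def by (rule fuzzy_partition_triangle) (use assms(1) m in auto)
  have A_nonneg: "0 \<le> A k l y" for k l y by (simp add: A_def triangle_nonneg)
  have pos: "0 < (\<Sum>j\<in>rules M. antecedent A j x)" if "x \<in> ?U" for x
  proof (rule sum_antecedent_pos[OF A_nonneg])
    show "\<exists>l\<in>{1..M}. 0 < A k l (x $ k)" for k
      using part[of k] that by (auto simp: fuzzy_partition_def fuzzy_complete_def mem_box_cart)
  qed
  define C where "C j = (\<chi> k. c k (j k))" for j
  have C_mem: "C j \<in> ?U" if "j \<in> rules M" for j
    using that part by (auto simp: C_def mem_box_cart rules_def fuzzy_partition_def PiE_iff)
  \<comment> \<open>An active rule has its centre within \<open>w k\<close> in every coordinate, and
    the Euclidean norm is at most the l1 norm.\<close>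
  have C_close: "dist x (C j) < \<eta>0" if "antecedent A j x \<noteq> 0" for x j
  proof -
    have "\<bar>(x - C j) $ k\<bar> \<le> w k" for k
    proof -
      have "A k (j k) (x $ k) \<noteq> 0" using that by (auto simp: antecedent_def)
      then have "0 < A k (j k) (x $ k)" using A_nonneg[of k "j k" "x $ k"] by linarith
      then show ?thesis using triangle_pos_iff[OF w] by (simp add: A_def C_def c_def less_imp_le)
    qed
    then have "(\<Sum>k\<in>UNIV. \<bar>(x - C j) $ k\<bar>) \<le> (\<Sum>k\<in>UNIV. w k)" by (rule sum_mono)
    then show ?thesis using norm_le_l1_cart[of "x - C j"] sum_w by (simp add: dist_norm)
  qed

  define \<theta> where "\<theta> j = f (C j)" for j
  \<comment> \<open>Taylor coefficients at the centre of rule \<open>j\<close>. They use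
    \<open>G\<close> because that centre may lie on the boundary. The degree range
    \<open>\<nu>\<close> in each coordinate is a box containing every multi-index of order at most
    \<open>\<nu>\<close>; its remaining coefficients are set to 0.\<close>
  define b where "b j d = (if d \<in> ?I then G d (C j) / (\<Prod>k\<in>UNIV. fact (d k)) else 0)" for j d
  define g where "g = disturbed_fuzzy_system M A (\<lambda>j. poly_fun (\<lambda>_. 0) (\<lambda>_. 1))
      (\<lambda>j. poly_fun (\<lambda>_. \<nu>) (b j))"
  have g: "g x = poly_fun (\<lambda>_. \<nu>) (\<lambda>d. static_fuzzy_system M A (\<lambda>j. b j d) x)" for x
    unfolding g_def by (rule disturbed_fuzzy_system_undisturbed_inputs)
  \<comment> \<open>The factorials produced by differentiation cancel those in
    \<open>b\<close>.\<close>
  have lim: "(multi_derivative i (g x) \<longlongrightarrow> static_fuzzy_system M A (\<lambda>j. G i (C j)) x) (at 0)"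
    if "i \<in> ?I" for i x
  proof -
    have "static_fuzzy_system M A (\<lambda>j. b j i) x * (\<Prod>k\<in>UNIV. fact (i k)) =
        static_fuzzy_system M A (\<lambda>j. b j i * (\<Prod>k\<in>UNIV. fact (i k))) x"
      by (simp add: static_fuzzy_system_def sum_distrib_right mult.assoc)
    also have "(\<lambda>j. b j i * (\<Prod>k\<in>UNIV. fact (i k))) = (\<lambda>j. G i (C j))"
      using that by (simp add: b_def)
    finally show ?thesis
      using tendsto_multi_derivative_poly_fun[of i "\<lambda>_. \<nu>"
          "\<lambda>d. static_fuzzy_system M A (\<lambda>j. b j d) x"] le_\<nu>[OF that]
      by (simp add: g)
  qed
  have bound: "\<bar>G i x - static_fuzzy_system M A (\<lambda>j. G i (C j)) x\<bar> \<le> \<epsilon> / 2"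
    if "i \<in> ?I" "x \<in> ?U" for i x
  proof (rule static_fuzzy_system_close[OF A_nonneg pos[OF that(2)]])
    fix j assume j: "j \<in> rules M" "antecedent A j x \<noteq> 0"
    then have "dist x (C j) < \<eta> i" using C_close \<eta>0(2)[OF that(1)] by fastforce
    then show "\<bar>G i x - G i (C j)\<bar> \<le> \<epsilon> / 2"
      using \<eta>(2)[OF that C_mem[OF j(1)]] by simp
  qed
  \<comment> \<open>The function \<open>y\<close> allows two uses: \<open>y = f\<close> at order
    zero, and \<open>y = multi_derivative_on ?U i f\<close> at positive order.\<close>
  have approx: "(\<forall>x\<in>Supp ?U f. \<exists>l. ((\<lambda>h. \<bar>y x - multi_derivative i (g x) h\<bar>) \<longlongrightarrow> l) (at 0)) \<and>
      (SUP x\<in>Supp ?U f. ennreal (Lim (at 0) (\<lambda>h. \<bar>y x - multi_derivative i (g x) h\<bar>))) < ennreal \<epsilon>"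
    if "i \<in> ?I" "\<And>x. x \<in> ?U \<Longrightarrow> y x = G i x" for i y
  proof -
    have l: "((\<lambda>h. \<bar>y x - multi_derivative i (g x) h\<bar>) \<longlongrightarrow>
        \<bar>y x - static_fuzzy_system M A (\<lambda>j. G i (C j)) x\<bar>) (at 0)" for x
      by (intro tendsto_intros lim that)
    show ?thesis
    proof
      show "\<forall>x\<in>Supp ?U f. \<exists>l. ((\<lambda>h. \<bar>y x - multi_derivative i (g x) h\<bar>) \<longlongrightarrow> l) (at 0)"
        using l by blast
      show "(SUP x\<in>Supp ?U f.
          ennreal (Lim (at 0) (\<lambda>h. \<bar>y x - multi_derivative i (g x) h\<bar>))) < ennreal \<epsilon>"
        using bound[OF that(1)] that(2)
        by (intro SUP_Lim_less[OF l _ assms(3)]) (auto simp: Supp_def)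
    qed
  qed
  \<comment> \<open>Claims (i) and (ii) thereby become the order-zero instances of
    \<open>lim\<close> and \<open>approx\<close>.\<close>
  have md0: "multi_derivative (\<lambda>_. 0) F = F" for F :: "real ^ 'n::{finite,linorder} \<Rightarrow> real"
  proof -
    have "foldr (\<lambda>_. id) ks F = F" for ks :: "'n list" by (induction ks) auto
    then show ?thesis by (simp add: multi_derivative_def)
  qed
  have "(g x \<longlongrightarrow> static_fuzzy_system M A \<theta> x) (at 0)" for x
    using lim[OF I0, of x] by (simp add: md0 G0 \<theta>_def[abs_def])
  moreover have "(\<forall>x\<in>Supp ?U f. \<exists>l. ((\<lambda>h. \<bar>f x - g x h\<bar>) \<longlongrightarrow> l) (at 0)) \<and>
      (SUP x\<in>Supp ?U f. ennreal (Lim (at 0) (\<lambda>h. \<bar>f x - g x h\<bar>))) < ennreal \<epsilon>"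
    using approx[OF I0, of f] by (simp add: md0 G0)
  moreover have "b j (\<lambda>_. 0) = \<theta> j" for j
    by (simp add: b_def G0 \<theta>_def)
  \<comment> \<open>The input disturbance has degree 0 and constant coefficient 1; the output
    disturbance has degree \<open>\<nu>\<close> in each coordinate.\<close>
  ultimately show ?thesis
    using part approx G(3)
    by (intro exI[of _ M] exI[of _ c] exI[of _ A] exI[of _ \<theta>] exI[of _ "\<lambda>_. 0"] exI[of _ "\<lambda>_. \<nu>"]
        exI[of _ "\<lambda>_ _. 1"] exI[of _ b]) (simp add: Let_def flip: g_def)
qed

end
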